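(* Let $X$ be a real normed space and $C\subset X$ a convex subset. Then $$\mathrm{DP}(C)=\mathrm{PC}(C)\cap\mathrm{ext}(\widehat{C}),$$ where points of $C$ are identified with their canonical images in $X^{**}$.
   Context: $X^*$, $X^{**}$ are the dual and bidual Banach spaces of $X$, $i_X:X\to X^{**}$ the canonical isometric inclusion. For $A\subset X$, the completion $\widehat{A}$ is the norm closure of $i_X(A)$ in $X^{**}$. For convex $C\subset X$ and $x\in C$: $x\in\mathrm{DP}(C)$ (denting point) if for every norm neighbourhood $U$ of $x$, $x\notin\overline{\mathrm{conv}}(C\setminus U)$; $x\in\mathrm{PC}(C)$ (point of continuity) if for every norm neighbourhood $U$ of $x$ there is a weak neighbourhood $W$ of $x$ with $W\cap C\subset U$. For a convex set $D$, $x\in\mathrm{ext}(D)$ if $x\in D$ and $x=\frac{d_1+d_2}{2}$ with $d_1,d_2\in D$ implies $x=d_1=d_2$. *)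

theory Defs
  imports "HOL-Analysis.Analysis"
begin

type_synonym 'a dual = "'a \<Rightarrow>\<^sub>L real"

lift_definition bidual_embed :: "'a::real_normed_vector \<Rightarrow> 'a dual dual"
  is "\<lambda>x f. blinfun_apply f x"
  by (rule blinfun.bounded_linear_left)

text \<open>
  The closure is taken in the operator norm topology of the bidual, a Banach space into which
  \<open>bidual_embed\<close> maps isometrically by Hahn-Banach.
\<close>

definition bidual_completion :: "'a::real_normed_vector set \<Rightarrow> 'a dual dual set"
  where "bidual_completion A = closure (bidual_embed ` A)"

definition weak_topology :: "'a::real_normed_vector topology"
  where "weak_topology = topology_generated_by {blinfun_apply f -` V | (f :: 'a dual) V. open V}"

text \<open>
  Neighbourhoods of \<open>x\<close> are arbitrary sets having \<open>x\<close> in their interior.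
\<close>

definition denting_points :: "'a::real_normed_vector set \<Rightarrow> 'a set"
  where "denting_points C =
    {x \<in> C. \<forall>U. x \<in> interior U \<longrightarrow> x \<notin> closure (convex hull (C - U))}"

definition points_of_continuity :: "'a::real_normed_vector set \<Rightarrow> 'a set"
  where "points_of_continuity C =
    {x \<in> C. \<forall>U. x \<in> interior U \<longrightarrow> (\<exists>W. x \<in> weak_topology interior_of W \<and> W \<inter> C \<subseteq> U)}"

definition extreme_points :: "'a::real_vector set \<Rightarrow> 'a set"
  where "extreme_points D =
    {x \<in> D. \<forall>d1\<in>D. \<forall>d2\<in>D. x = (d1 + d2) /\<^sub>R 2 \<longrightarrow> x = d1 \<and> x = d2}"

text \<open>
  For convex sets the midpoint condition agrees with the library's segment condition.
\<close>

lemma extreme_points_eq_extreme_point_of: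
  assumes "convex D"
  shows "extreme_points D = {x. x extreme_point_of D}"
proof (intro set_eqI iffI CollectI)
  fix x assume x: "x \<in> extreme_points D"
  show "x extreme_point_of D"
    unfolding extreme_point_of_def
  proof (intro conjI ballI notI)
    show "x \<in> D" using x by (simp add: extreme_points_def)
  next
    fix a b assume ab: "a \<in> D" "b \<in> D" and "x \<in> open_segment a b"
    then obtain u where u: "a \<noteq> b" "0 < u" "u < 1" "x = (1 - u) *\<^sub>R a + u *\<^sub>R b"
      by (auto simp: in_segment)
    define e where "e = min u (1 - u)"
    have e: "0 < e" "e \<le> u" "e \<le> 1 - u" using u by (auto simp: e_def)
    let ?p = "\<lambda>v. (1 - v) *\<^sub>R a + v *\<^sub>R b"
    have "?p (u + e) \<in> D" "?p (u - e) \<in> D"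
      using assms ab e u by (auto intro!: convexD)
    moreover have "x = (?p (u + e) + ?p (u - e)) /\<^sub>R 2"
    proof -
      have "?p (u + e) + ?p (u - e) = x + x"
        by (simp add: u(4) algebra_simps)
      then show ?thesis by (simp flip: scaleR_2)
    qed
    ultimately have "x = ?p (u + e)"
      using x unfolding extreme_points_def by blast
    then have "e *\<^sub>R (b - a) = 0"
      using u(4) by (auto simp: algebra_simps)
    then show False using e u(1) by simp
  qed
next
  fix x assume x: "x \<in> {x. x extreme_point_of D}"
  have "x = d1 \<and> x = d2" if d: "d1 \<in> D" "d2 \<in> D" "x = (d1 + d2) /\<^sub>R 2" for d1 d2
  proof (cases "d1 = d2")
    case True
    then show ?thesis using d(3) by (simp flip: scaleR_2)
  next
    case False
    then have "x \<in> open_segment d1 d2"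
      using d(3) unfolding in_segment
      by (intro conjI exI[of _ "1/2"]) (auto simp: algebra_simps)
    then show ?thesis using x d by (auto simp: extreme_point_of_def)
  qed
  then show "x \<in> extreme_points D"
    using x by (auto simp: extreme_points_def extreme_point_of_def)
qed

end

theory Submission
  imports Defs
begin

text \<open>
  The inclusion from left to right is Hahn-Banach separation (for points of continuity) and a direct
  approximation of the two halves of a segment (for extremality). For the converse, a point \<open>x\<close> that is
  not denting lies in the closed convex hull of the part of \<open>C\<close> on a small sphere around \<open>x\<close>. Weak
  continuity at \<open>x\<close> covers that part by finitely many bounded slices whose closures miss \<open>x\<close>, and
  an extreme point of continuity in the closed convex hull of finitely many bounded convex pieces
  of \<open>C\<close> lies in the closure of one of them.
\<close>

subsection \<open>Linear minorants and separation\<close>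

text \<open>Homogeneity is stated as an inequality for positive \<open>t\<close>, the form that
  infima inherit most directly; equality for \<open>t\<close> \<ge> 0 follows by scaling
  back.\<close>

definition sublinear :: "('a::real_vector \<Rightarrow> real) \<Rightarrow> bool"
  where "sublinear q \<longleftrightarrow>
    (\<forall>x y. q (x + y) \<le> q x + q y) \<and> (\<forall>t>0. \<forall>x. q (t *\<^sub>R x) \<le> t * q x)"

lemma sublinear_add: "sublinear q \<Longrightarrow> q (x + y) \<le> q x + q y"
  by (simp add: sublinear_def)

lemma sublinear_scaleR_le: "sublinear q \<Longrightarrow> t > 0 \<Longrightarrow> q (t *\<^sub>R x) \<le> t * q x"
  by (simp add: sublinear_def)

lemma sublinear_zero:
  assumes "sublinear q"
  shows "q 0 = 0"
  using sublinear_add[OF assms, of 0 0] sublinear_scaleR_le[OF assms, of "1/2" 0] by simp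

lemma sublinear_scaleR:
  assumes "sublinear q" "t \<ge> 0"
  shows "q (t *\<^sub>R x) = t * q x"
proof (cases "t = 0")
  case True
  then show ?thesis using sublinear_zero[OF assms(1)] by simp
next
  case False
  with assms(2) have t: "t > 0" by simp
  have "q (inverse t *\<^sub>R t *\<^sub>R x) \<le> inverse t * q (t *\<^sub>R x)"
    using t by (intro sublinear_scaleR_le[OF assms(1)]) simp
  with t have "t * q x \<le> q (t *\<^sub>R x)" by (simp add: field_simps)
  with sublinear_scaleR_le[OF assms(1) t, of x] show ?thesis by simp
qed

lemma sublinear_minus: "sublinear q \<Longrightarrow> - q (- x) \<le> q x"
  using sublinear_add[of q x "- x"] sublinear_zero[of q] by simp

text \<open>Common tool for the three infima below. Members need not be sublinear: an index
  \<open>k\<close> may depend on \<open>i\<close> and \<open>j\<close>, and taking infima over these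
  one at a time passes the inequality on.\<close>

lemma sublinear_INF:
  fixes F :: "'i \<Rightarrow> 'a::real_vector \<Rightarrow> real"
  assumes "K \<noteq> {}"
    and bdd: "\<And>x. bdd_below ((\<lambda>i. F i x) ` K)"
    and add: "\<And>i j x y. i \<in> K \<Longrightarrow> j \<in> K \<Longrightarrow> \<exists>k\<in>K. F k (x + y) \<le> F i x + F j y"
    and scale: "\<And>i t x. i \<in> K \<Longrightarrow> t > 0 \<Longrightarrow> \<exists>k\<in>K. F k (t *\<^sub>R x) \<le> t * F i x"
  shows "sublinear (\<lambda>x. INF i\<in>K. F i x)"
  unfolding sublinear_def
proof (intro conjI allI impI)
  fix x y
  let ?p = "\<lambda>x. INF i\<in>K. F i x"
  have *: "?p (x + y) \<le> F i x + F j y" if "i \<in> K" "j \<in> K" for i j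
    using add[OF that, of x y] cINF_lower[OF bdd] by (meson order_trans)
  have "?p (x + y) - F i x \<le> ?p y" if "i \<in> K" for i
    using *[OF that] by (intro cINF_greatest[OF assms(1)]) (simp add: algebra_simps)
  then have "?p (x + y) - ?p y \<le> ?p x"
    by (intro cINF_greatest[OF assms(1)]) (simp add: algebra_simps)
  then show "?p (x + y) \<le> ?p x + ?p y" by simp
next
  fix t :: real and x assume t: "t > 0"
  let ?p = "\<lambda>x. INF i\<in>K. F i x"
  have "?p (t *\<^sub>R x) \<le> t * F i x" if "i \<in> K" for i
    using scale[OF that t, of x] cINF_lower[OF bdd] by (meson order_trans)
  then have "?p (t *\<^sub>R x) / t \<le> ?p x"
    using t by (intro cINF_greatest[OF assms(1)]) (simp add: field_simps)
  then show "?p (t *\<^sub>R x) \<le> t * ?p x" using t by (simp add: field_simps)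
qed

text \<open>Lowering \<open>q\<close> along a fixed direction \<open>y\<close> yields a sublinear
  function below \<open>q\<close>. By minimality nothing was lowered, which forces
  additivity.\<close>

lemma minimal_sublinear_linear:
  assumes q: "sublinear q"
    and min: "\<And>q'. sublinear q' \<Longrightarrow> q' \<le> q \<Longrightarrow> q' = q"
  shows "linear q"
proof -
  have superadd: "q x + q y \<le> q (x + y)" for x y
  proof -
    \<comment> \<open>The member at \<open>t = 0\<close> is \<open>q\<close>, so the infimum is at
      most \<open>q\<close> and hence equal to it; the member at \<open>t = 1\<close> then gives
      superadditivity.\<close>
    let ?F = "\<lambda>t x. q (x + t *\<^sub>R y) - t * q y"
    let ?q' = "\<lambda>x. INF t\<in>{0..}. ?F t x"
    have "- q (- z) \<le> ?F t z" if "t \<in> {0..}" for t z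
      using that sublinear_add[OF q, of "z + t *\<^sub>R y" "- z"] sublinear_scaleR[OF q, of t y] by simp
    then have bdd: "bdd_below ((\<lambda>t. ?F t z) ` {0..})" for z
      by (rule bdd_belowI2)
    have "sublinear ?q'"
    proof (rule sublinear_INF)
      fix i j :: real and u v assume "i \<in> {0..}" "j \<in> {0..}"
      moreover have "?F (i + j) (u + v) \<le> ?F i u + ?F j v"
        using sublinear_add[OF q, of "u + i *\<^sub>R y" "v + j *\<^sub>R y"] by (simp add: algebra_simps)
      ultimately show "\<exists>k\<in>{0..}. ?F k (u + v) \<le> ?F i u + ?F j v"
        by (intro bexI[of _ "i + j"]) auto
    next
      fix i t :: real and u assume "i \<in> {0..}" "t > 0"
      moreover from this have "?F (t * i) (t *\<^sub>R u) \<le> t * ?F i u"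
        using sublinear_scaleR_le[OF q, of t "u + i *\<^sub>R y"] by (simp add: algebra_simps)
      ultimately show "\<exists>k\<in>{0..}. ?F k (t *\<^sub>R u) \<le> t * ?F i u"
        by (intro bexI[of _ "t * i"]) auto
    qed (use bdd in auto)
    moreover have "?q' \<le> q"
    proof (rule le_funI)
      fix z show "?q' z \<le> q z"
        using cINF_lower[OF bdd, of 0 z] by simp
    qed
    ultimately have "q x = ?q' x" by (intro fun_cong[OF min[symmetric]])
    also have "?q' x \<le> ?F 1 x"
      using bdd by (rule cINF_lower) simp
    finally show ?thesis by simp
  qed
  have add: "q (x + y) = q x + q y" for x y
    using superadd sublinear_add[OF q] by (intro antisym)
  have neg: "q (- x) = - q x" for x
    using add[of x "- x"] sublinear_zero[OF q] by simp
  show ?thesis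
  proof (rule linearI)
    fix r x
    show "q (r *\<^sub>R x) = r *\<^sub>R q x"
    proof (cases "r \<ge> 0")
      case True
      then show ?thesis using sublinear_scaleR[OF q] by simp
    next
      case False
      then show ?thesis using sublinear_scaleR[OF q, of "- r" x] neg[of "r *\<^sub>R x"] by simp
    qed
  qed (rule add)
qed

text \<open>Hahn-Banach by minimality: Zorn's lemma is applied to the sublinear functions below
  \<open>p\<close> instead of partial linear extensions.\<close>

lemma linear_minorant:
  assumes p: "sublinear p"
  obtains f where "linear f" "f \<le> p"
proof -
  let ?A = "{q. sublinear q \<and> q \<le> p}"
  \<comment> \<open>The order is reversed, so that a maximal element is a minimal function and
    chains are bounded by their pointwise infima.\<close>
  let ?P = "\<lambda>q q' :: 'a \<Rightarrow> real. q' \<le> q"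
  have "\<exists>m\<in>?A. \<forall>a\<in>?A. ?P m a \<longrightarrow> a = m"
  proof (rule predicate_Zorn)
    show "partial_order_on ?A (relation_of ?P ?A)"
      by (rule partial_order_on_relation_ofI) auto
  next
    fix K assume "K \<in> Chains (relation_of ?P ?A)"
    then have K: "K \<subseteq> ?A" and chain: "\<And>a b. a \<in> K \<Longrightarrow> b \<in> K \<Longrightarrow> a \<le> b \<or> b \<le> a"
      by (auto simp: Chains_def relation_of_def)
    show "\<exists>u\<in>?A. \<forall>a\<in>K. ?P a u"
    proof (cases "K = {}")
      case True
      then show ?thesis using p by auto
    next
      case False
      \<comment> \<open>A bound depending on \<open>p\<close> alone keeps the infimum over the chain
        finite.\<close>
      have "- p (- x) \<le> q x" if "q \<in> K" for q x
      proof -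
        have "sublinear q" "q (- x) \<le> p (- x)" using that K by (auto simp: le_fun_def)
        then show ?thesis using sublinear_minus[of q x] by simp
      qed
      then have bdd: "bdd_below ((\<lambda>q. q x) ` K)" for x
        by (rule bdd_belowI2)
      let ?u = "\<lambda>x. INF q\<in>K. q x"
      have le: "?u \<le> q" if "q \<in> K" for q
        using cINF_lower[OF bdd that] by (auto simp: le_fun_def)
      have "sublinear ?u"
      proof (rule sublinear_INF)
        fix a b x y assume ab: "a \<in> K" "b \<in> K"
        define k where "k = (if a \<le> b then a else b)"
        have "k \<in> K" "k \<le> a" "k \<le> b"
          using ab chain by (auto simp: k_def)
        moreover from this have "k (x + y) \<le> k x + k y" "k x \<le> a x" "k y \<le> b y"
          using K sublinear_add[of k x y] by (auto simp: le_fun_def)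
        ultimately show "\<exists>k\<in>K. k (x + y) \<le> a x + b y"
          by (intro bexI[of _ k]) auto
      next
        fix a and t :: real and x assume "a \<in> K" "t > 0"
        then show "\<exists>k\<in>K. k (t *\<^sub>R x) \<le> t * a x"
          using K sublinear_scaleR_le[of a t x] by auto
      qed (use False bdd in auto)
      moreover have "?u \<le> p"
      proof -
        obtain q where "q \<in> K" using False by auto
        then show ?thesis using le[of q] K by (blast intro: order_trans)
      qed
      ultimately show ?thesis using le by (intro bexI[of _ ?u]) auto
    qed
  qed
  then obtain m where m: "sublinear m" "m \<le> p"
    and min: "\<And>a. sublinear a \<Longrightarrow> a \<le> p \<Longrightarrow> a \<le> m \<Longrightarrow> a = m"
    by auto
  have "linear m"
    using m(1) by (rule minimal_sublinear_linear) (meson min m(2) order_trans)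
  with m(2) show thesis by (rule that[rotated])
qed

text \<open>One sublinear function encodes both demands on a linear \<open>f\<close> below it:
  \<open>t = 0\<close> bounds \<open>f\<close> by the norm, and \<open>t = 1\<close> with
  \<open>y = - e\<close> gives \<open>f (- e)\<close> \<le> \<open>- r\<close>.\<close>

lemma separate_convex_from_zero:
  fixes E :: "'a::real_normed_vector set"
  assumes "convex E" "E \<noteq> {}" and far: "\<And>e. e \<in> E \<Longrightarrow> r \<le> norm e"
  obtains f :: "'a dual" where "norm f \<le> 1" "\<And>e. e \<in> E \<Longrightarrow> r \<le> f e"
proof -
  let ?K = "{0::real..} \<times> E"
  let ?F = "\<lambda>(t, e) y. norm (y + t *\<^sub>R e) - t * r"
  let ?p = "\<lambda>y. INF i\<in>?K. ?F i y"
  have lower: "- norm y \<le> ?F i y" if K: "i \<in> ?K" for i y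
  proof -
    obtain t e where i: "i = (t, e)" "t \<ge> 0" "e \<in> E" using K by auto
    have "t * r \<le> t * norm e" using i far by (intro mult_left_mono)
    also have "\<dots> \<le> norm (y + t *\<^sub>R e) + norm y"
      using i norm_triangle_ineq4[of "y + t *\<^sub>R e" y] by simp
    finally show ?thesis using i by simp
  qed
  then have bdd: "bdd_below ((\<lambda>i. ?F i y) ` ?K)" for y
    by (rule bdd_belowI2)
  have "sublinear ?p"
  proof (rule sublinear_INF)
    fix i j x y assume "i \<in> ?K" "j \<in> ?K"
    then obtain s d t e where ij: "i = (s, d)" "j = (t, e)" "s \<ge> 0" "t \<ge> 0" "d \<in> E" "e \<in> E"
      by auto
    \<comment> \<open>Convexity merges the two shifts into one by \<open>s + t\<close> times a point
      of \<open>E\<close>; if both are 0, any point serves.\<close>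
    obtain c where c: "c \<in> E" "(s + t) *\<^sub>R c = s *\<^sub>R d + t *\<^sub>R e"
    proof (cases "s + t = 0")
      case True
      then show thesis using ij that[of d] by (simp add: add_nonneg_eq_0_iff)
    next
      case False
      then have "(s / (s + t)) *\<^sub>R d + (t / (s + t)) *\<^sub>R e \<in> E"
        using ij assms(1) by (intro convexD) (auto simp: add_divide_distrib[symmetric])
      then show thesis using False by (intro that) (auto simp: scaleR_add_right)
    qed
    have "?F (s + t, c) (x + y) \<le> ?F i x + ?F j y"
      using norm_triangle_ineq[of "x + s *\<^sub>R d" "y + t *\<^sub>R e"] c(2) ij by (simp add: algebra_simps)
    then show "\<exists>k\<in>?K. ?F k (x + y) \<le> ?F i x + ?F j y"
      using ij c(1) by (intro bexI[of _ "(s + t, c)"]) auto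
  next
    fix i x and s :: real assume "i \<in> ?K" "s > 0"
    then obtain t e where i: "i = (t, e)" "t \<ge> 0" "e \<in> E" and s: "s > 0" by auto
    have "norm (s *\<^sub>R (x + t *\<^sub>R e)) = s * norm (x + t *\<^sub>R e)" using s by simp
    then have "?F (s * t, e) (s *\<^sub>R x) \<le> s * ?F i x"
      using i by (simp add: algebra_simps)
    then show "\<exists>k\<in>?K. ?F k (s *\<^sub>R x) \<le> s * ?F i x"
      using i s by (intro bexI[of _ "(s * t, e)"]) auto
  qed (use assms(2) bdd in auto)
  then obtain f where f: "linear f" "f \<le> ?p" by (rule linear_minorant)
  have f_le: "f y \<le> norm (y + t *\<^sub>R e) - t * r" if "t \<ge> 0" "e \<in> E" for y t e
  proof -
    have "f y \<le> ?p y" using f(2) by (rule le_funD)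
    also have "\<dots> \<le> ?F (t, e) y" using that by (intro cINF_lower[OF bdd]) auto
    finally show ?thesis by simp
  qed
  have f_norm: "f y \<le> norm y" for y
    using assms(2) f_le[of 0 _ y] by auto
  have f_abs: "norm (f y) \<le> norm y * 1" for y
    using f_norm[of y] f_norm[of "- y"] linear_neg[OF f(1), of y] by simp
  then have bl: "bounded_linear f"
    using f(1) by (intro bounded_linear_intro[of f 1]) (auto simp: linear_add linear_scale)
  show thesis
  proof
    show "norm (Blinfun f) \<le> 1"
      using f_abs bounded_linear_Blinfun_apply[OF bl] by (intro norm_blinfun_bound) auto
    show "r \<le> Blinfun f e" if "e \<in> E" for e
      using f_le[of 1 e "- e"] that linear_neg[OF f(1), of e] bounded_linear_Blinfun_apply[OF bl]
      by simp
  qed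
qed

subsection \<open>The canonical embedding\<close>

lemma bidual_embed_apply [simp]: "bidual_embed x f = f x"
  by transfer simp

lemma norm_bidual_embed [simp]: "norm (bidual_embed x) = norm x"
proof (rule antisym)
  show "norm (bidual_embed x) \<le> norm x"
  proof (rule norm_blinfun_bound)
    show "norm (bidual_embed x f) \<le> norm x * norm f" for f
      using norm_blinfun[of f x] by (simp add: mult.commute)
  qed simp
  \<comment> \<open>A norming functional, from separating \<open>{x}\<close> from 0 at distance
    \<open>norm x\<close>.\<close>
  obtain f :: "'a dual" where f: "norm f \<le> 1" "norm x \<le> f x"
    using separate_convex_from_zero[of "{x}" "norm x"] by auto
  have "f x \<le> norm (bidual_embed x f)" by simp
  also have "\<dots> \<le> norm (bidual_embed x) * norm f" by (rule norm_blinfun)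
  also have "\<dots> \<le> norm (bidual_embed x) * 1" using f by (intro mult_left_mono) auto
  finally show "norm x \<le> norm (bidual_embed x)" using f by simp
qed

lemma linear_bidual_embed: "linear bidual_embed"
  by (rule linearI) (auto intro!: blinfun_eqI simp: blinfun.bilinear_simps)

lemma bounded_linear_bidual_embed: "bounded_linear bidual_embed"
  by (rule bounded_linear_intro[of _ 1])
    (auto simp: linear_add[OF linear_bidual_embed] linear_scale[OF linear_bidual_embed])

lemma dist_bidual_embed [simp]: "dist (bidual_embed x) (bidual_embed y) = dist x y"
  by (simp add: dist_norm linear_diff[OF linear_bidual_embed, symmetric])

lemma convex_bidual_completion: "convex C \<Longrightarrow> convex (bidual_completion C)"
  unfolding bidual_completion_def
  by (intro convex_closure convex_linear_image linear_bidual_embed)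

subsection \<open>Weak neighbourhoods\<close>

lemma weak_topology_half_space:
  fixes f :: "'a::real_normed_vector dual"
  shows "openin weak_topology {y. f y < a}"
proof -
  have "{y. f y < a} = f -` {..<a}" by auto
  then show ?thesis
    unfolding weak_topology_def by (auto intro!: topology_generated_by_Basis exI[of _ f] exI[of _ "{..<a}"])
qed

text \<open>One-sided bounds by the constant 1 suffice: a two-sided bound of width \<open>e\<close>
  comes from the pair \<open>f / e\<close>, \<open>- f / e\<close>. In the induction, intersections
  unite the finite sets of functionals.\<close>

lemma weak_topology_base:
  fixes x :: "'a::real_normed_vector"
  assumes "openin weak_topology W" "x \<in> W"
  obtains F :: "'a dual set" where "finite F" "{y. \<forall>f\<in>F. blinfun_apply f (y - x) < 1} \<subseteq> W"
proof -
  let ?N = "\<lambda>F :: 'a dual set. {y. \<forall>f\<in>F. blinfun_apply f (y - x) < 1}"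
  have "generate_topology_on {blinfun_apply f -` V | (f :: 'a dual) V. open V} W"
    using assms(1) by (simp add: weak_topology_def openin_topology_generated_by_iff)
  then have "x \<in> W \<longrightarrow> (\<exists>F. finite F \<and> ?N F \<subseteq> W)"
  proof induction
    case Empty
    show ?case by simp
  next
    case (Int a b)
    show ?case
    proof
      assume "x \<in> a \<inter> b"
      then obtain F G where "finite F" "?N F \<subseteq> a" "finite G" "?N G \<subseteq> b"
        using Int.IH by blast
      then show "\<exists>F. finite F \<and> ?N F \<subseteq> a \<inter> b"
        by (intro exI[of _ "F \<union> G"] conjI subsetI IntI) (simp, blast+)
    qed
  next
    case (UN K)
    show ?case
    proof
      assume "x \<in> \<Union>K"
      then obtain k where k: "k \<in> K" "x \<in> k" by blast
      with UN.IH obtain F where "finite F" "?N F \<subseteq> k" by blast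
      with k(1) show "\<exists>F. finite F \<and> ?N F \<subseteq> \<Union>K" by blast
    qed
  next
    case (Basis s)
    then obtain f :: "'a dual" and V where s: "s = f -` V" "open V" by auto
    show ?case
    proof
      assume "x \<in> s"
      then obtain e where e: "e > 0" "ball (f x) e \<subseteq> V"
        using s by (auto elim: openE)
      have in_V: "f y \<in> V" if "y \<in> ?N {f /\<^sub>R e, - f /\<^sub>R e}" for y
      proof -
        have "\<bar>f y - f x\<bar> < e"
          using that e(1) by (auto simp: blinfun.bilinear_simps abs_less_iff field_simps)
        then show ?thesis using e(2) by (auto simp: dist_real_def abs_minus_commute)
      qed
      then show "\<exists>F. finite F \<and> ?N F \<subseteq> s"
        unfolding s(1) by (intro exI[of _ "{f /\<^sub>R e, - f /\<^sub>R e}"] conjI subsetI vimageI2 in_V) simp_all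
    qed
  qed
  with assms(2) that show thesis by blast
qed

lemma points_of_continuity_base:
  fixes x :: "'a::real_normed_vector"
  assumes "x \<in> points_of_continuity C" "e > 0"
  shows "\<exists>F :: 'a dual set. finite F \<and> (\<forall>y\<in>C. (\<forall>f\<in>F. blinfun_apply f (y - x) < 1) \<longrightarrow> dist x y < e)"
proof -
  have "x \<in> interior (ball x e)" using assms(2) by simp
  then obtain W where W: "x \<in> weak_topology interior_of W" "W \<inter> C \<subseteq> ball x e"
    using assms(1) unfolding points_of_continuity_def by blast
  obtain F :: "'a dual set" where F: "finite F" "{y. \<forall>f\<in>F. blinfun_apply f (y - x) < 1} \<subseteq> weak_topology interior_of W"
    using weak_topology_base[OF openin_interior_of W(1)] .
  have "dist x y < e" if "y \<in> C" "\<forall>f\<in>F. blinfun_apply f (y - x) < 1" for y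
  proof -
    have "y \<in> W \<inter> C" using F(2) that interior_of_subset by fastforce
    then show ?thesis using W(2) by auto
  qed
  with F(1) show ?thesis by blast
qed

subsection \<open>Denting points are extreme points of continuity\<close>

lemma denting_imp_point_of_continuity:
  assumes x: "x \<in> denting_points C"
  shows "x \<in> points_of_continuity C"
  unfolding points_of_continuity_def
proof (intro CollectI conjI allI impI)
  show "x \<in> C" using x by (simp add: denting_points_def)
  fix U assume U: "x \<in> interior U"
  let ?D = "convex hull (C - U)"
  have "x \<notin> closure ?D" using x U by (simp add: denting_points_def)
  then obtain r where r: "r > 0" "\<And>d. d \<in> ?D \<Longrightarrow> r \<le> dist d x"
    unfolding closure_approachable by (auto simp: not_less)
  show "\<exists>W. x \<in> weak_topology interior_of W \<and> W \<inter> C \<subseteq> U"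
  proof (cases "C \<subseteq> U")
    case True
    \<comment> \<open>Separation needs a nonempty set, so this case stands apart. The whole space is
      weakly open as a half-space of the zero functional.\<close>
    have "openin weak_topology {y. (0 :: 'a dual) y < 1}" by (rule weak_topology_half_space)
    with True show ?thesis
      by (intro exI[of _ UNIV]) (auto simp: interior_of_def)
  next
    case False
    obtain f :: "'a dual" where f: "\<And>e. e \<in> (\<lambda>d. d - x) ` ?D \<Longrightarrow> r \<le> f e"
    proof (rule separate_convex_from_zero[of "(\<lambda>d. d - x) ` ?D" r])
      show "convex ((\<lambda>d. d - x) ` ?D)" by (simp add: convex_translation_subtract)
      show "(\<lambda>d. d - x) ` ?D \<noteq> {}" using False by auto
    qed (use r(2) in \<open>auto simp: dist_norm\<close>)
    let ?W = "{y. f y < f x + r}"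
    have "?W \<inter> C \<subseteq> U"
    proof
      fix y assume y: "y \<in> ?W \<inter> C"
      show "y \<in> U"
      proof (rule ccontr)
        assume "y \<notin> U"
        then have "y \<in> ?D" using y by (simp add: hull_inc)
        then have "r \<le> f (y - x)" using f by blast
        then show False using y by (simp add: blinfun.diff_right)
      qed
    qed
    moreover have "x \<in> weak_topology interior_of ?W"
      using weak_topology_half_space[of f "f x + r"] r(1) by (simp add: interior_of_openin)
    ultimately show ?thesis by blast
  qed
qed

text \<open>Endpoints other than the image of \<open>x\<close> lie at equal distance
  \<open>r\<close> > 0 from it. Approximating both from \<open>C\<close> gives points away from
  \<open>x\<close> with midpoints arbitrarily close to \<open>x\<close>; the isometry carries the
  estimates from the bidual back to the space.\<close>

lemma denting_imp_extreme:
  assumes x: "x \<in> denting_points C"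
  shows "bidual_embed x \<in> extreme_points (bidual_completion C)"
  unfolding extreme_points_def
proof (intro CollectI conjI ballI impI)
  let ?i = bidual_embed
  have "x \<in> C" using x by (simp add: denting_points_def)
  then show "?i x \<in> bidual_completion C"
    using closure_subset[of "?i ` C"] by (auto simp: bidual_completion_def)
  fix d1 d2
  assume d: "d1 \<in> bidual_completion C" "d2 \<in> bidual_completion C" and mid: "?i x = (d1 + d2) /\<^sub>R 2"
  define r where "r = norm (d1 - ?i x)"
  have d2: "?i x - d2 = d1 - ?i x"
    using mid by (simp add: algebra_simps flip: scaleR_2)
  have "r = 0"
  proof (rule ccontr)
    assume "r \<noteq> 0"
    then have r: "r > 0" by (simp add: r_def)
    let ?D = "convex hull (C - ball x (r / 2))"
    have "x \<in> closure ?D"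
      unfolding closure_approachable
    proof (intro allI impI)
      fix e :: real assume e: "e > 0"
      \<comment> \<open>The bound \<open>e\<close> brings the midpoint close to \<open>x\<close>;
        \<open>r / 2\<close> keeps the approximants outside the ball.\<close>
      define h where "h = min e (r / 2)"
      have h: "h > 0" using e r by (simp add: h_def)
      have approx: "\<exists>a\<in>C - ball x (r / 2). dist (?i a) c < h"
        if c: "c \<in> bidual_completion C" "dist c (?i x) = r" for c
      proof -
        obtain a where a: "a \<in> C" "dist (?i a) c < h"
          using c(1) h unfolding bidual_completion_def closure_approachable by auto
        have "r \<le> dist (?i a) c + dist a x"
          using c(2) dist_triangle2[of c "?i x" "?i a"] by (simp add: dist_commute)
        with a h have "a \<notin> ball x (r / 2)" by (simp add: h_def dist_commute)
        with a show ?thesis by blast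
      qed
      obtain a where a: "a \<in> C - ball x (r / 2)" "dist (?i a) d1 < h"
        using approx[OF d(1)] by (auto simp: r_def dist_norm)
      obtain b where b: "b \<in> C - ball x (r / 2)" "dist (?i b) d2 < h"
      proof -
      have "dist d2 (?i x) = r" using d2 by (metis dist_commute dist_norm r_def)
      then show thesis using approx[OF d(2)] that by blast
    qed
      let ?m = "(1/2) *\<^sub>R a + (1/2) *\<^sub>R b"
      have "?m \<in> ?D" using a b by (intro convexD convex_convex_hull hull_inc) auto
      moreover have "dist ?m x < e"
      proof -
        have "?i ?m - ?i x = (1/2) *\<^sub>R (?i a - d1) + (1/2) *\<^sub>R (?i b - d2)"
          unfolding mid by (simp add: linear_add[OF linear_bidual_embed]
            linear_scale[OF linear_bidual_embed] algebra_simps)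
        then have "dist (?i ?m) (?i x) \<le> (1/2) * dist (?i a) d1 + (1/2) * dist (?i b) d2"
          using norm_triangle_ineq[of "(1/2) *\<^sub>R (?i a - d1)" "(1/2) *\<^sub>R (?i b - d2)"]
          by (simp add: dist_norm)
        then show ?thesis using a b by (simp add: h_def)
      qed
      ultimately show "\<exists>y\<in>?D. dist y x < e" by blast
    qed
    moreover have "x \<in> interior (ball x (r / 2))" using r by simp
    ultimately show False using x unfolding denting_points_def by blast
  qed
  then show "?i x = d1" "?i x = d2" using d2 by (auto simp: r_def)
qed

subsection \<open>Extreme points of continuity are denting\<close>

text \<open>A countable product of compact intervals is compact and metrizable, hence sequentially
  compact; this stands in for a diagonal argument.\<close>

lemma seq_subseq_pointwise_convergent:
  fixes s :: "nat \<Rightarrow> nat \<Rightarrow> real"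
  assumes "\<And>n k. \<bar>s k n\<bar> \<le> B n"
  obtains \<sigma> where "strict_mono \<sigma>" "\<And>n. convergent (\<lambda>k. s (\<sigma> k) n)"
proof -
  have "compact (PiE UNIV (\<lambda>n. {- B n..B n}))"
    unfolding compactin_euclidean_iff[symmetric] euclidean_product_topology[symmetric]
    by (simp add: compactin_PiE)
  moreover have "s k \<in> PiE UNIV (\<lambda>n. {- B n..B n})" for k
    using assms by (auto simp: abs_le_iff minus_le_iff)
  ultimately obtain l \<sigma> where l: "strict_mono \<sigma>" "(s \<circ> \<sigma>) \<longlonglongrightarrow> l"
    unfolding compact_eq_seq_compact_metric seq_compact_def by blast
  show thesis
  proof (rule that[OF l(1)])
    fix n
    have "(\<lambda>k. s (\<sigma> k) n) \<longlonglongrightarrow> l n"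
      using continuous_on_tendsto_compose[OF continuous_on_product_coordinates l(2)] by (simp add: o_def)
    then show "convergent (\<lambda>k. s (\<sigma> k) n)" by (rule convergentI)
  qed
qed

text \<open>
  Moving the points outside the ball radially towards \<open>x\<close> onto the sphere only brings their convex
  combinations, suitably reweighted, closer to \<open>x\<close>.
\<close>

lemma closure_convex_hull_sphere:
  fixes x :: "'a::real_normed_vector"
  assumes "convex C" "x \<in> C" "r > 0" and x: "x \<in> closure (convex hull (C - ball x r))"
  shows "x \<in> closure (convex hull (C \<inter> sphere x r))"
proof -
  let ?S = "convex hull (C \<inter> sphere x r)"
  \<comment> \<open>The points that some contraction towards \<open>x\<close> sends into
    \<open>?S\<close>. Being convex and containing \<open>C - ball x r\<close>, this set contains
    the hull.\<close>
  let ?Q = "{y. \<exists>t. 0 < t \<and> t \<le> 1 \<and> x + t *\<^sub>R (y - x) \<in> ?S}"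
  have "convex ?Q"
  proof (rule convexI)
    fix y z and u v :: real
    assume "y \<in> ?Q" "z \<in> ?Q" and uv: "0 \<le> u" "0 \<le> v" "u + v = 1"
    then obtain a b where a: "0 < a" "a \<le> 1" "x + a *\<^sub>R (y - x) \<in> ?S"
      and b: "0 < b" "b \<le> 1" "x + b *\<^sub>R (z - x) \<in> ?S" by auto
    \<comment> \<open>The weights \<open>u / a\<close> and \<open>v / b\<close> undo the two
      contractions. Dividing by their total \<open>w\<close> restores a convex combination, and
      \<open>w\<close> \<ge> 1 makes \<open>1 / w\<close> an admissible factor.\<close>
    define w where "w = u / a + v / b"
    have "u \<le> u / a" "v \<le> v / b"
      using a b uv by (auto simp: le_divide_eq mult_left_le)
    then have w: "1 \<le> w" using uv by (simp add: w_def)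
    let ?y = "x + a *\<^sub>R (y - x)" and ?z = "x + b *\<^sub>R (z - x)"
    have weights: "u / a / w + v / b / w = 1"
      using w unfolding add_divide_distrib[symmetric] w_def[symmetric] by simp
    then have "(u / a / w) *\<^sub>R ?y + (v / b / w) *\<^sub>R ?z \<in> ?S"
      using a b uv w by (intro convexD convex_convex_hull) auto
    also have "(u / a / w) *\<^sub>R ?y + (v / b / w) *\<^sub>R ?z =
      (u / a / w + v / b / w) *\<^sub>R x + (1 / w) *\<^sub>R (u *\<^sub>R (y - x) + v *\<^sub>R (z - x))"
      using a b by (simp add: scaleR_add_right scaleR_add_left del: scaleR_right_diff_distrib)
    also have "u *\<^sub>R (y - x) + v *\<^sub>R (z - x) = u *\<^sub>R y + v *\<^sub>R z - (u + v) *\<^sub>R x"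
      by (simp add: algebra_simps)
    finally have "x + (1 / w) *\<^sub>R (u *\<^sub>R y + v *\<^sub>R z - x) \<in> ?S"
      using weights uv by simp
    then show "u *\<^sub>R y + v *\<^sub>R z \<in> ?Q"
      using w by (intro CollectI exI[of _ "1 / w"]) auto
  qed
  moreover have "C - ball x r \<subseteq> ?Q"
  proof
    fix y assume y: "y \<in> C - ball x r"
    define t where "t = r / norm (y - x)"
    have le: "r \<le> norm (y - x)" using y by (simp add: dist_norm norm_minus_commute)
    then have pos: "0 < norm (y - x)" using assms(3) by linarith
    with le have t: "0 < t" "t \<le> 1" using assms(3) by (auto simp: t_def)
    have "(1 - t) *\<^sub>R x + t *\<^sub>R y \<in> C"
      using t y assms(1,2) by (intro convexD) auto
    moreover have "(1 - t) *\<^sub>R x + t *\<^sub>R y = x + t *\<^sub>R (y - x)" by (simp add: algebra_simps)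
    moreover have "dist x (x + t *\<^sub>R (y - x)) = r"
      using pos assms(3) by (simp add: dist_norm t_def)
    ultimately have "x + t *\<^sub>R (y - x) \<in> ?S" by (intro hull_inc) auto
    with t show "y \<in> ?Q" by blast
  qed
  ultimately have sub: "convex hull (C - ball x r) \<subseteq> ?Q" by (rule hull_minimal[rotated])
  show ?thesis
    unfolding closure_approachable
  proof (intro allI impI)
    fix e :: real assume "e > 0"
    then obtain y where y: "y \<in> convex hull (C - ball x r)" "dist y x < e"
      using x unfolding closure_approachable by blast
    then obtain t where t: "0 < t" "t \<le> 1" "x + t *\<^sub>R (y - x) \<in> ?S" using sub by blast
    have "t * norm (y - x) \<le> norm (y - x)" using t by (intro mult_left_le_one_le) auto
    then have "dist (x + t *\<^sub>R (y - x)) x < e" using t y(2) by (simp add: dist_norm)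
    with t(3) show "\<exists>z\<in>?S. dist z x < e" by blast
  qed
qed

text \<open>Combinations of one point from each set already form a convex set. Nonemptiness supplies
  a partner of weight 0 for a point of either set.\<close>

lemma in_convex_hull_Un:
  assumes "convex A" "convex B" "A \<noteq> {}" "B \<noteq> {}" "y \<in> convex hull (A \<union> B)"
  obtains a b t where "a \<in> A" "b \<in> B" "0 \<le> t" "t \<le> 1" "y = t *\<^sub>R a + (1 - t) *\<^sub>R b"
proof -
  let ?Q = "{t *\<^sub>R a + (1 - t) *\<^sub>R b | a b t. a \<in> A \<and> b \<in> B \<and> 0 \<le> t \<and> t \<le> 1}"
  \<comment> \<open>Two weighted points of a convex set merge into one carrying the total weight;
    this form also covers total weight 0.\<close>
  have comb: "\<exists>c\<in>D. (p + q) *\<^sub>R c = p *\<^sub>R c1 + q *\<^sub>R c2"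
    if "convex D" "c1 \<in> D" "c2 \<in> D" "0 \<le> p" "0 \<le> q" for p q and c1 c2 :: 'a and D
  proof (cases "p + q = 0")
    case True
    then show ?thesis using that by (auto simp: add_nonneg_eq_0_iff)
  next
    case False
    then have "(p / (p + q)) *\<^sub>R c1 + (q / (p + q)) *\<^sub>R c2 \<in> D"
      using that by (intro convexD) (auto simp: add_divide_distrib[symmetric])
    then show ?thesis using False
      by (intro bexI[of _ "(p / (p + q)) *\<^sub>R c1 + (q / (p + q)) *\<^sub>R c2"]) (auto simp: scaleR_add_right)
  qed
  have "convex ?Q"
  proof (rule convexI)
    fix y z and u v :: real
    assume "y \<in> ?Q" "z \<in> ?Q" and uv: "0 \<le> u" "0 \<le> v" "u + v = 1"
    then obtain a b s a' b' t where
      y: "y = s *\<^sub>R a + (1 - s) *\<^sub>R b" "a \<in> A" "b \<in> B" "0 \<le> s" "s \<le> 1" and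
      z: "z = t *\<^sub>R a' + (1 - t) *\<^sub>R b'" "a' \<in> A" "b' \<in> B" "0 \<le> t" "t \<le> 1"
      by blast
    define w where "w = u * s + v * t"
    obtain c where c: "c \<in> A" "w *\<^sub>R c = (u * s) *\<^sub>R a + (v * t) *\<^sub>R a'"
      using comb[OF assms(1) y(2) z(2), of "u * s" "v * t"] uv y z by (auto simp: w_def)
    have w': "1 - w = u * (1 - s) + v * (1 - t)" using uv by (simp add: w_def algebra_simps)
    obtain d where d: "d \<in> B" "(1 - w) *\<^sub>R d = (u * (1 - s)) *\<^sub>R b + (v * (1 - t)) *\<^sub>R b'"
      using comb[OF assms(2) y(3) z(3), of "u * (1 - s)" "v * (1 - t)"] uv y z
      by (auto simp: w')
    have "0 \<le> w" using uv y z by (simp add: w_def)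
    moreover have "0 \<le> 1 - w" unfolding w' using uv y z by simp
    moreover have "u *\<^sub>R y + v *\<^sub>R z = w *\<^sub>R c + (1 - w) *\<^sub>R d"
      unfolding c d y z by (simp add: scaleR_add_right)
    ultimately show "u *\<^sub>R y + v *\<^sub>R z \<in> ?Q"
      using c(1) d(1) by (intro CollectI exI[of _ c] exI[of _ d] exI[of _ w]) simp
  qed
  moreover have "A \<union> B \<subseteq> ?Q"
  proof
    fix y assume y: "y \<in> A \<union> B"
    obtain a b where ab: "a \<in> A" "b \<in> B" using assms by auto
    show "y \<in> ?Q"
    proof (cases "y \<in> A")
      case True
      with ab show ?thesis by (intro CollectI exI[of _ y] exI[of _ b] exI[of _ 1]) simp
    next
      case False
      with y ab show ?thesis by (intro CollectI exI[of _ a] exI[of _ y] exI[of _ 0]) simp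
    qed
  qed
  ultimately have "convex hull (A \<union> B) \<subseteq> ?Q" by (rule hull_minimal[rotated])
  then have "y \<in> ?Q" using assms(5) by (rule subsetD)
  then show thesis using that by blast
qed

text \<open>
  Given \<open>t\<^sub>k a\<^sub>k + (1 - t\<^sub>k) b\<^sub>k \<longlonglongrightarrow> x\<close> with \<open>0 < lim t\<^sub>k < 1\<close>, pass to a subsequence along which the
  countably many functionals witnessing the continuity of \<open>x\<close> converge on \<open>a\<^sub>k\<close>. Then replacing \<open>a\<^sub>k\<close> by
  another \<open>a\<^sub>j\<close> keeps the combination weakly, hence in norm, close to \<open>x\<close>: so \<open>a\<^sub>k\<close> and \<open>b\<^sub>k\<close> are
  Cauchy, and extremality of \<open>x\<close> makes their limits equal to \<open>x\<close>.
\<close>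

lemma extreme_point_of_continuity_closure_Un:
  fixes x :: "'a::real_normed_vector"
  assumes C: "convex C" and pc: "x \<in> points_of_continuity C"
    and ext: "bidual_embed x \<in> extreme_points (bidual_completion C)"
    and A: "convex A" "bounded A" "A \<subseteq> C" and B: "convex B" "bounded B" "B \<subseteq> C"
    and x: "x \<in> closure (convex hull (A \<union> B))"
  shows "x \<in> closure A \<or> x \<in> closure B"
proof (cases "A = {} \<or> B = {}")
  case True
  then show ?thesis using x A(1) B(1) by (auto simp: hull_same)
next
  case False
  let ?i = bidual_embed
  obtain y where y: "\<And>k. y k \<in> convex hull (A \<union> B)" "y \<longlonglongrightarrow> x"
    using x unfolding closure_sequential by blast
  have "\<exists>a b t. a \<in> A \<and> b \<in> B \<and> t \<in> {0..1} \<and> y k = t *\<^sub>R a + (1 - t) *\<^sub>R b" for k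
    using in_convex_hull_Un[OF A(1) B(1) _ _ y(1)[of k]] False by (metis atLeastAtMost_iff)
  then obtain a b t where ab: "\<And>k. a k \<in> A" "\<And>k. b k \<in> B" and t: "\<And>k. t k \<in> {0..1::real}"
    and yk: "\<And>k. y k = t k *\<^sub>R a k + (1 - t k) *\<^sub>R b k"
    by metis
  obtain M where M: "M > 0" "\<And>c. c \<in> A \<union> B \<Longrightarrow> norm c \<le> M"
    using bounded_pos[of "A \<union> B"] A(2) B(2) by auto
  have "\<forall>m. \<exists>F :: 'a dual set. finite F \<and>
      (\<forall>y\<in>C. (\<forall>f\<in>F. blinfun_apply f (y - x) < 1) \<longrightarrow> dist x y < inverse (Suc m))"
    by (intro allI points_of_continuity_base[OF pc]) simp
  then obtain F :: "nat \<Rightarrow> 'a dual set" where F: "\<And>m. finite (F m)"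
    "\<And>m y. y \<in> C \<Longrightarrow> (\<forall>f\<in>F m. blinfun_apply f (y - x) < 1) \<Longrightarrow> dist x y < inverse (Suc m)"
    by metis
  \<comment> \<open>Inserting \<open>0\<close> keeps the set nonempty, so that \<open>g\<close> can
    enumerate it even if every \<open>F m\<close> is empty.\<close>
  have "countable (insert 0 (\<Union>m. F m))" using F(1) by (simp add: countable_finite)
  then obtain g :: "nat \<Rightarrow> 'a dual" where g: "insert 0 (\<Union>m. F m) = range g"
    by (metis insert_not_empty uncountable_def)
  obtain l s where s: "l \<in> {0..1}" "strict_mono s" "(t \<circ> s) \<longlonglongrightarrow> l"
    using compact_Icc[of 0 "1::real"] t unfolding compact_def by metis
  have "\<bar>g n (a (s k))\<bar> \<le> norm (g n) * M" for n k
  proof -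
    have "\<bar>g n (a (s k))\<bar> \<le> norm (g n) * norm (a (s k))" using norm_blinfun[of "g n"] by simp
    also have "\<dots> \<le> norm (g n) * M" using M(2) ab by (intro mult_left_mono) auto
    finally show ?thesis .
  qed
  then obtain s' where s': "strict_mono s'" "\<And>n. convergent (\<lambda>k. g n (a (s (s' k))))"
    by (rule seq_subseq_pointwise_convergent[of "\<lambda>k n. g n (a (s k))"]) blast
  define \<sigma> where "\<sigma> = s \<circ> s'"
  have \<sigma>: "strict_mono \<sigma>" using s(2) s'(1) by (simp add: \<sigma>_def strict_mono_o)
  define p where "p = (\<lambda>k. a (\<sigma> k))"
  define q where "q = (\<lambda>k. b (\<sigma> k))"
  have p: "p k \<in> A" "norm (p k) \<le> M" and q: "q k \<in> B" "norm (q k) \<le> M" for k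
    using ab M(2) by (auto simp: p_def q_def)
  \<comment> \<open>The limit weight \<open>l\<close> replaces the varying weights; as
    \<open>p\<close> and \<open>q\<close> are bounded, the change tends to 0.\<close>
  define z where "z = (\<lambda>k. l *\<^sub>R p k + (1 - l) *\<^sub>R q k)"
  have "(\<lambda>k. (l - t (\<sigma> k)) *\<^sub>R (p k - q k)) \<longlonglongrightarrow> 0"
  proof (rule Lim_null_comparison)
    have "norm ((l - t (\<sigma> k)) *\<^sub>R (p k - q k)) \<le> \<bar>l - t (\<sigma> k)\<bar> * (M + M)" for k
      using norm_triangle_ineq4[of "p k" "q k"] p(2)[of k] q(2)[of k]
      by (auto intro!: mult_left_mono)
    then show "\<forall>\<^sub>F k in sequentially. norm ((l - t (\<sigma> k)) *\<^sub>R (p k - q k)) \<le> \<bar>l - t (\<sigma> k)\<bar> * (M + M)"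
      by simp
    have "(\<lambda>k. t (\<sigma> k)) \<longlonglongrightarrow> l"
      using LIMSEQ_subseq_LIMSEQ[OF s(3) s'(1)] by (simp add: \<sigma>_def o_def)
    then have "(\<lambda>k. \<bar>l - t (\<sigma> k)\<bar> * (M + M)) \<longlonglongrightarrow> \<bar>l - l\<bar> * (M + M)"
      by (intro tendsto_intros)
    then show "(\<lambda>k. \<bar>l - t (\<sigma> k)\<bar> * (M + M)) \<longlonglongrightarrow> 0" by simp
  qed
  then have "(\<lambda>k. y (\<sigma> k) + (l - t (\<sigma> k)) *\<^sub>R (p k - q k)) \<longlonglongrightarrow> x + 0"
    using LIMSEQ_subseq_LIMSEQ[OF y(2) \<sigma>] by (intro tendsto_add) (simp_all add: o_def)
  moreover have "y (\<sigma> k) + (l - t (\<sigma> k)) *\<^sub>R (p k - q k) = z k" for k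
    by (simp add: yk z_def p_def q_def algebra_simps)
  ultimately have z: "z \<longlonglongrightarrow> x" by simp
  consider "l = 0" | "l = 1" | "0 < l" "l < 1" using s(1) by fastforce
  then show ?thesis
  proof cases
    case 1
    then have "q \<longlonglongrightarrow> x" using z by (simp add: z_def)
    then show ?thesis using q(1) unfolding closure_sequential by metis
  next
    case 2
    then have "p \<longlonglongrightarrow> x" using z by (simp add: z_def)
    then show ?thesis using p(1) unfolding closure_sequential by metis
  next
    case 3
    \<comment> \<open>The indices of \<open>p\<close> and \<open>q\<close> are decoupled. For late
      indices, passing from \<open>p k\<close> to \<open>p j\<close> and from \<open>x\<close> to
      \<open>z k\<close> each raises \<open>f\<close> by less than 1/2, within the allowed
      1.\<close>
    have swap: "\<exists>N. \<forall>j\<ge>N. \<forall>k\<ge>N. dist x (l *\<^sub>R p j + (1 - l) *\<^sub>R q k) < inverse (Suc m)" for m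
    proof -
      have "\<exists>N. \<forall>j\<ge>N. \<forall>k\<ge>N. f (l *\<^sub>R p j + (1 - l) *\<^sub>R q k - x) < 1" if f: "f \<in> F m" for f
      proof -
        obtain n where n: "f = g n" using f g by blast
        have "convergent (\<lambda>k. f (p k))" using s'(2)[of n] n by (simp add: p_def \<sigma>_def)
        then obtain N1 where N1: "\<And>j k. j \<ge> N1 \<Longrightarrow> k \<ge> N1 \<Longrightarrow> dist (f (p j)) (f (p k)) < 1/2"
          unfolding Cauchy_convergent_iff[symmetric] Cauchy_def
          by (metis half_gt_zero_iff zero_less_one)
        have "(\<lambda>k. f (z k)) \<longlonglongrightarrow> f x" using z by (intro tendsto_intros)
        then obtain N2 where N2: "\<And>k. k \<ge> N2 \<Longrightarrow> dist (f (z k)) (f x) < 1/2"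
          unfolding lim_sequentially by (metis half_gt_zero_iff zero_less_one)
        show ?thesis
        proof (intro exI[of _ "max N1 N2"] allI impI)
          fix j k assume jk: "j \<ge> max N1 N2" "k \<ge> max N1 N2"
          then have "dist (f (p j)) (f (p k)) < 1/2" "dist (f (z k)) (f x) < 1/2"
            using N1 N2 by auto
          then have close: "\<bar>f (p j) - f (p k)\<bar> < 1/2" "f (z k) - f x < 1/2"
            unfolding dist_real_def by linarith+
          have "f (l *\<^sub>R p j + (1 - l) *\<^sub>R q k - x) = l * (f (p j) - f (p k)) + (f (z k) - f x)"
            by (simp add: z_def blinfun.bilinear_simps algebra_simps)
          also have "l * (f (p j) - f (p k)) \<le> l * \<bar>f (p j) - f (p k)\<bar>"
            using 3 by (intro mult_left_mono) auto
          also have "\<dots> \<le> \<bar>f (p j) - f (p k)\<bar>" using 3 by (intro mult_left_le_one_le) auto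
          also note close(1)
          also note close(2)
          finally show "f (l *\<^sub>R p j + (1 - l) *\<^sub>R q k - x) < 1" by simp
        qed
      qed
      then obtain N where N: "\<And>f j k. f \<in> F m \<Longrightarrow> j \<ge> N f \<Longrightarrow> k \<ge> N f \<Longrightarrow>
          blinfun_apply f (l *\<^sub>R p j + (1 - l) *\<^sub>R q k - x) < 1"
        by metis
      \<comment> \<open>Finiteness of \<open>F m\<close> gives one threshold for all its
        functionals; the inserted 0 covers an empty \<open>F m\<close>.\<close>
      have "dist x (l *\<^sub>R p j + (1 - l) *\<^sub>R q k) < inverse (Suc m)"
        if "j \<ge> Max (insert 0 (N ` F m))" "k \<ge> Max (insert 0 (N ` F m))" for j k
      proof (intro F(2) ballI)
        show "l *\<^sub>R p j + (1 - l) *\<^sub>R q k \<in> C"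
          using 3 p(1)[of j] q(1)[of k] A(3) B(3) by (intro convexD[OF C]) auto
        fix f assume f: "f \<in> F m"
        then have "N f \<le> Max (insert 0 (N ` F m))" using F(1) by (intro Max_ge) auto
        then show "f (l *\<^sub>R p j + (1 - l) *\<^sub>R q k - x) < 1" using f that by (intro N) auto
      qed
      then show ?thesis by blast
    qed
    \<comment> \<open>With \<open>q N\<close> held fixed, both combinations are near
      \<open>x\<close>, so \<open>p j\<close> and \<open>p k\<close> are near each other.
      Completeness of the bidual supplies a limit that the space itself may lack.\<close>
    have "Cauchy (\<lambda>k. ?i (p k))"
      unfolding Cauchy_def
    proof (intro allI impI)
      fix e :: real assume e: "e > 0"
      then obtain m where m: "inverse (Suc m) < l * e / 2"
        using reals_Archimedean[of "l * e / 2"] 3 by auto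
      obtain N where N: "\<And>j k. j \<ge> N \<Longrightarrow> k \<ge> N \<Longrightarrow> dist x (l *\<^sub>R p j + (1 - l) *\<^sub>R q k) < l * e / 2"
        using swap[of m] m by (meson less_trans)
      have "dist (p j) (p k) < e" if "j \<ge> N" "k \<ge> N" for j k
      proof -
        have "l * dist (p j) (p k) = dist (l *\<^sub>R p j + (1 - l) *\<^sub>R q N) (l *\<^sub>R p k + (1 - l) *\<^sub>R q N)"
          using 3 by (simp add: dist_norm flip: scaleR_diff_right)
        also have "\<dots> < l * e"
          using N[of j N] N[of k N] that dist_triangle3[of "l *\<^sub>R p j + (1 - l) *\<^sub>R q N"
            "l *\<^sub>R p k + (1 - l) *\<^sub>R q N" x] by simp
        finally show ?thesis using 3 by simp
      qed
      then show "\<exists>N. \<forall>j\<ge>N. \<forall>k\<ge>N. dist (?i (p j)) (?i (p k)) < e" by auto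
    qed
    then obtain u where u: "(\<lambda>k. ?i (p k)) \<longlonglongrightarrow> u"
      by (meson Cauchy_convergent convergent_def)
    \<comment> \<open>Chosen so that \<open>?i x\<close> is the combination of \<open>u\<close> and
      \<open>v\<close> with weights \<open>l\<close> and \<open>1 - l\<close>; solving for
      \<open>?i (q k)\<close> in the same way shows that it tends to \<open>v\<close>.\<close>
    define v where "v = (1 / (1 - l)) *\<^sub>R (?i x - l *\<^sub>R u)"
    have "(\<lambda>k. ?i (z k)) \<longlonglongrightarrow> ?i x"
      by (rule bounded_linear.tendsto[OF bounded_linear_bidual_embed z])
    then have "(\<lambda>k. (1 / (1 - l)) *\<^sub>R (?i (z k) - l *\<^sub>R ?i (p k))) \<longlonglongrightarrow> v"
      unfolding v_def using u by (intro tendsto_intros)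
    moreover have "(1 / (1 - l)) *\<^sub>R (?i (z k) - l *\<^sub>R ?i (p k)) = ?i (q k)" for k
      using 3 by (simp add: z_def linear_add[OF linear_bidual_embed] linear_scale[OF linear_bidual_embed])
    ultimately have v: "(\<lambda>k. ?i (q k)) \<longlonglongrightarrow> v" by simp
    have uv: "u \<in> bidual_completion C" "v \<in> bidual_completion C"
    proof -
      have "?i (p k) \<in> ?i ` C" "?i (q k) \<in> ?i ` C" for k
        using p(1)[of k] q(1)[of k] A(3) B(3) by auto
      with u v show "u \<in> bidual_completion C" "v \<in> bidual_completion C"
        unfolding bidual_completion_def closure_sequential by metis+
    qed
    have xuv: "?i x = (1 - (1 - l)) *\<^sub>R u + (1 - l) *\<^sub>R v" using 3 by (simp add: v_def)
    have "?i x extreme_point_of bidual_completion C"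
      using ext extreme_points_eq_extreme_point_of[OF convex_bidual_completion[OF C]] by simp
    then have "?i x \<notin> open_segment u v" using uv by (auto simp: extreme_point_of_def)
    moreover have "?i x \<in> open_segment u v" if "u \<noteq> v"
      using 3 xuv that unfolding in_segment by (intro conjI exI[of _ "1 - l"]) auto
    ultimately have "u = v" by blast
    \<comment> \<open>The combination collapses, and the isometry pulls the convergence back to the
      space.\<close>
    then have "u = ?i x" using xuv by (simp flip: scaleR_add_left)
    with u have "(\<lambda>k. dist (?i (p k)) (?i x)) \<longlonglongrightarrow> 0"
      unfolding tendsto_dist_iff[of "\<lambda>k. ?i (p k)"] by simp
    then have "p \<longlonglongrightarrow> x"
      unfolding tendsto_dist_iff[of p] by simp
    then show ?thesis using p(1) unfolding closure_sequential by metis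
  qed
qed

text \<open>Induction splits off one piece; the hull of the others is again a bounded convex subset
  of \<open>C\<close>, so the two-set lemma applies.\<close>

lemma extreme_point_of_continuity_closure_Union:
  fixes x :: "'a::real_normed_vector"
  assumes C: "convex C" and pc: "x \<in> points_of_continuity C"
    and ext: "bidual_embed x \<in> extreme_points (bidual_completion C)"
    and "finite I" and "\<And>i. i \<in> I \<Longrightarrow> convex (A i) \<and> bounded (A i) \<and> A i \<subseteq> C"
    and "x \<in> closure (convex hull (\<Union>i\<in>I. A i))"
  shows "\<exists>i\<in>I. x \<in> closure (A i)"
  using assms(4-)
proof (induction I rule: finite_induct)
  case empty
  then show ?case by simp
next
  case (insert i I)
  let ?B = "convex hull (\<Union>i\<in>I. A i)"
  have "x \<in> closure (A i) \<or> x \<in> closure ?B"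
  proof (rule extreme_point_of_continuity_closure_Un[OF C pc ext])
    show "bounded ?B"
      using insert.prems(1) insert.hyps(1) by (auto intro!: bounded_convex_hull)
    show "?B \<subseteq> C"
      using insert.prems(1) C by (intro hull_minimal) auto
    have "convex hull (\<Union>i\<in>insert i I. A i) \<subseteq> convex hull (A i \<union> ?B)"
      by (intro hull_mono) (auto intro: hull_inc)
    then show "x \<in> closure (convex hull (A i \<union> ?B))"
      using insert.prems(2) closure_mono by blast
  qed (use insert.prems(1) in auto)
  then show ?case using insert by auto
qed

lemma extreme_point_of_continuity_imp_denting:
  fixes x :: "'a::real_normed_vector"
  assumes C: "convex C" and pc: "x \<in> points_of_continuity C"
    and ext: "bidual_embed x \<in> extreme_points (bidual_completion C)"
  shows "x \<in> denting_points C"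
  unfolding denting_points_def
proof (intro CollectI conjI allI impI notI)
  show xC: "x \<in> C" using pc by (simp add: points_of_continuity_def)
  fix U assume "x \<in> interior U" and x: "x \<in> closure (convex hull (C - U))"
  then obtain r where r: "r > 0" "ball x r \<subseteq> U" by (auto simp: mem_interior)
  then have "convex hull (C - U) \<subseteq> convex hull (C - ball x r)" by (intro hull_mono) auto
  then have "x \<in> closure (convex hull (C - ball x r))" using x closure_mono by blast
  then have sphere: "x \<in> closure (convex hull (C \<inter> sphere x r))"
    by (rule closure_convex_hull_sphere[OF C xC r(1)])
  obtain F :: "'a dual set" where F: "finite F"
    "\<And>y. y \<in> C \<Longrightarrow> (\<forall>f\<in>F. blinfun_apply f (y - x) < 1) \<Longrightarrow> dist x y < r"
    using points_of_continuity_base[OF pc r(1)] by blast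
  \<comment> \<open>The closed ball makes the pieces bounded, as the union lemma requires; the
    closed half-space keeps \<open>x\<close> out of their closures. They cover the sphere because
    \<open>dist x y = r\<close> there violates some bound from \<open>F\<close>.\<close>
  define A where "A = (\<lambda>f :: 'a dual. C \<inter> cball x r \<inter> {y. 1 + f x \<le> f y})"
  have half_space: "convex {y. 1 + f x \<le> f y}" "closed {y. 1 + f x \<le> f y}" for f :: "'a dual"
  proof -
    have "{y. 1 + f x \<le> f y} = f -` {1 + f x..}" by auto
    then show "convex {y. 1 + f x \<le> f y}"
      by (simp add: convex_linear_vimage blinfun.bounded_linear_right bounded_linear.linear)
    show "closed {y. 1 + f x \<le> f y}"
      by (intro closed_Collect_le continuous_intros)
  qed
  have "\<exists>f\<in>F. x \<in> closure (A f)"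
  proof (rule extreme_point_of_continuity_closure_Union[OF C pc ext F(1)])
    show "convex (A f) \<and> bounded (A f) \<and> A f \<subseteq> C" for f
      using half_space C by (auto simp: A_def intro!: convex_Int bounded_Int)
    have "C \<inter> sphere x r \<subseteq> (\<Union>f\<in>F. A f)"
    proof
      fix y assume y: "y \<in> C \<inter> sphere x r"
      then obtain f where "f \<in> F" "1 + f x \<le> f y"
        using F(2)[of y] by (force simp: not_less blinfun.diff_right)
      then show "y \<in> (\<Union>f\<in>F. A f)" using y by (auto simp: A_def)
    qed
    then show "x \<in> closure (convex hull (\<Union>f\<in>F. A f))"
      using sphere by (meson closure_mono hull_mono subsetD)
  qed
  then obtain f where "x \<in> closure (A f)" by blast
  moreover have "closure (A f) \<subseteq> {y. 1 + f x \<le> f y}"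
    using half_space(2) by (intro closure_minimal) (auto simp: A_def)
  ultimately show False by auto
qed

theorem corollary2p21:
  fixes C :: "'a::real_normed_vector set"
  assumes "convex C"
  shows "bidual_embed ` denting_points C =
    bidual_embed ` points_of_continuity C \<inter> extreme_points (bidual_completion C)"
proof (intro equalityI subsetI)
  fix z assume "z \<in> bidual_embed ` denting_points C"
  then show "z \<in> bidual_embed ` points_of_continuity C \<inter> extreme_points (bidual_completion C)"
    using denting_imp_point_of_continuity denting_imp_extreme by auto
next
  fix z assume "z \<in> bidual_embed ` points_of_continuity C \<inter> extreme_points (bidual_completion C)"
  then show "z \<in> bidual_embed ` denting_points C"
    using extreme_point_of_continuity_imp_denting[OF assms] by auto
qed

end
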